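(* Let $(X,\mathcal T)$ be a topological space, and let $\mathcal T_l$ be the topology on $X$ having the family of all $\mathcal T$-locally closed subsets of $X$ as a base. Then $(X,\mathcal T)$ is indiscrete if and only if $(X,\mathcal T_l)$ is a connected space.
   Context: No separation axioms are assumed. A subset $A$ of a topological space $X$ is locally closed if for every $x\in A$ there is an open set $U\subseteq X$ such that $x\in U$ and $A\cap U$ is closed in $U$ (equivalently, $A$ is the intersection of an open set and a closed set). Finite intersections of locally closed sets are locally closed, so the $\mathcal T$-locally closed sets form a base for a topology $\mathcal T_l\supseteq\mathcal T$ on $X$. *)

theory Defs
  imports "HOL-Analysis.Analysis"
begin

definition indiscrete_space :: "'a topology \<Rightarrow> bool" where
  "indiscrete_space X \<longleftrightarrow> (\<forall>U. openin X U \<longleftrightarrow> U = {} \<or> U = topspace X)"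

definition locally_closedin :: "'a topology \<Rightarrow> 'a set \<Rightarrow> bool" where
  "locally_closedin X A \<longleftrightarrow> A \<subseteq> topspace X \<and>
     (\<forall>x\<in>A. \<exists>U. openin X U \<and> x \<in> U \<and> closedin (subtopology X U) (A \<inter> U))"

(* The open sets are the arbitrary unions of locally closed sets. Since "topology" is only
   meaningful on families satisfying "istopology", this is justified by
   openin_locally_closed_topology below. *)
definition locally_closed_topology :: "'a topology \<Rightarrow> 'a topology" where
  "locally_closed_topology X = topology (arbitrary union_of locally_closedin X)"

lemma locally_closedin_Int:
  assumes "locally_closedin X A" "locally_closedin X B"
  shows "locally_closedin X (A \<inter> B)"
  unfolding locally_closedin_def
proof (intro conjI ballI)
  show "A \<inter> B \<subseteq> topspace X"
    using assms by (auto simp: locally_closedin_def)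
next
  fix x assume "x \<in> A \<inter> B"
  then obtain U V where U: "openin X U" "x \<in> U" "closedin (subtopology X U) (A \<inter> U)"
    and V: "openin X V" "x \<in> V" "closedin (subtopology X V) (B \<inter> V)"
    using assms unfolding locally_closedin_def by blast
  from U(3) V(3) obtain C D where C: "closedin X C" "A \<inter> U = C \<inter> U"
    and D: "closedin X D" "B \<inter> V = D \<inter> V"
    by (auto simp: closedin_subtopology)
  have "(A \<inter> B) \<inter> (U \<inter> V) = (C \<inter> D) \<inter> (U \<inter> V)"
    using C(2) D(2) by blast
  moreover have "closedin X (C \<inter> D)"
    using C(1) D(1) by (rule closedin_Int)
  ultimately have "closedin (subtopology X (U \<inter> V)) ((A \<inter> B) \<inter> (U \<inter> V))"
    unfolding closedin_subtopology by blast
  moreover have "openin X (U \<inter> V)"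
    using U(1) V(1) by (rule openin_Int)
  ultimately show "\<exists>W. openin X W \<and> x \<in> W \<and> closedin (subtopology X W) ((A \<inter> B) \<inter> W)"
    using U(2) V(2) by blast
qed

lemma openin_locally_closed_topology:
  "openin (locally_closed_topology X) = arbitrary union_of locally_closedin X"
  unfolding locally_closed_topology_def
  by (intro topology_inverse' istopology_base locally_closedin_Int)

end

theory Submission
  imports Defs
begin

text \<open>
  Open sets and closed sets are both locally closed, so every open set of \<open>X\<close> becomes clopen in
  the locally closed topology; connectedness of the latter therefore leaves only the trivial open
  sets. Conversely, in an indiscrete space the only neighbourhood of a point is the whole space,
  so a nonempty locally closed set is globally closed, hence the whole space, and the locally
  closed topology is again indiscrete.
\<close>

text \<open>The set is its own witnessing neighbourhood at each of its points.\<close>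

lemma openin_imp_locally_closedin:
  assumes "openin X U"
  shows "locally_closedin X U"
  unfolding locally_closedin_def
proof (intro conjI ballI)
  show "U \<subseteq> topspace X"
    using assms by (rule openin_subset)
  then have "closedin (subtopology X U) (U \<inter> U)"
    using closedin_topspace[of "subtopology X U"] by (simp add: inf.absorb2)
  then show "\<exists>V. openin X V \<and> x \<in> V \<and> closedin (subtopology X V) (U \<inter> V)" if "x \<in> U" for x
    using assms that by blast
qed

text \<open>Here the whole space is the witnessing neighbourhood at every point.\<close>

lemma closedin_imp_locally_closedin:
  assumes "closedin X C"
  shows "locally_closedin X C"
  unfolding locally_closedin_def
proof (intro conjI ballI)
  show sub: "C \<subseteq> topspace X"
    using assms by (rule closedin_subset)
  then have "closedin (subtopology X (topspace X)) (C \<inter> topspace X)"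
    using assms by (simp add: inf.absorb1)
  then show "\<exists>V. openin X V \<and> x \<in> V \<and> closedin (subtopology X V) (C \<inter> V)" if "x \<in> C" for x
    using sub that by blast
qed

lemma openin_locally_closed_topologyI:
  assumes "locally_closedin X A"
  shows "openin (locally_closed_topology X) A"
  using assms unfolding openin_locally_closed_topology by (rule arbitrary_union_of_inc)

lemma topspace_locally_closed_topology [simp]:
  "topspace (locally_closed_topology X) = topspace X"
proof
  have "(arbitrary union_of locally_closedin X) (topspace (locally_closed_topology X))"
    using openin_topspace[of "locally_closed_topology X"]
    by (simp only: openin_locally_closed_topology)
  then show "topspace (locally_closed_topology X) \<subseteq> topspace X"
    unfolding union_of_def locally_closedin_def by blast
  show "topspace X \<subseteq> topspace (locally_closed_topology X)"
    by (intro openin_subset openin_locally_closed_topologyI openin_imp_locally_closedin openin_topspace)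
qed

text \<open>The complement of an open set is closed, hence locally closed, hence open in the finer topology.\<close>

lemma openin_imp_clopen_locally_closed_topology:
  assumes "openin X U"
  shows "openin (locally_closed_topology X) U" "closedin (locally_closed_topology X) U"
proof -
  show "openin (locally_closed_topology X) U"
    using assms by (intro openin_locally_closed_topologyI openin_imp_locally_closedin)
  have "openin (locally_closed_topology X) (topspace X - U)"
    using assms by (intro openin_locally_closed_topologyI closedin_imp_locally_closedin) auto
  then show "closedin (locally_closed_topology X) U"
    using openin_subset[OF assms] by (simp add: closedin_def)
qed

lemma indiscrete_space_closedin:
  assumes "indiscrete_space X" "closedin X C"
  shows "C = {} \<or> C = topspace X"
proof -
  have C: "C \<subseteq> topspace X" and "openin X (topspace X - C)"
    using assms(2) by (simp_all add: closedin_def)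
  then have "topspace X - C = {} \<or> topspace X - C = topspace X"
    using assms(1) unfolding indiscrete_space_def by simp
  with C show ?thesis
    by blast
qed

lemma locally_closedin_indiscrete_space:
  assumes "indiscrete_space X" "locally_closedin X A"
  shows "A = {} \<or> A = topspace X"
proof (cases "A = {}")
  case False
  then obtain x U where "openin X U" "x \<in> U" and A: "closedin (subtopology X U) (A \<inter> U)"
    using assms(2) unfolding locally_closedin_def by blast
  then have "U = topspace X"
    using assms(1) unfolding indiscrete_space_def by auto
  then have "closedin X A"
    using A assms(2) unfolding locally_closedin_def by (simp add: inf.absorb1)
  then show ?thesis
    using indiscrete_space_closedin[OF assms(1)] by blast
qed simp

lemma openin_locally_closed_topology_indiscrete_space:
  assumes "indiscrete_space X" "openin (locally_closed_topology X) V"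
  shows "V = {} \<or> V = topspace X"
proof -
  obtain \<U> where "\<U> \<subseteq> Collect (locally_closedin X)" and V: "V = \<Union>\<U>"
    using assms(2) unfolding openin_locally_closed_topology union_of_def by blast
  then have "\<U> \<subseteq> {{}, topspace X}"
    using locally_closedin_indiscrete_space[OF assms(1)] by blast
  then show ?thesis
    unfolding V by blast
qed

theorem proposition2p3:
  fixes X :: "'a topology"
  shows "indiscrete_space X \<longleftrightarrow> connected_space (locally_closed_topology X)"
proof
  assume "indiscrete_space X"
  from openin_locally_closed_topology_indiscrete_space[OF this]
  show "connected_space (locally_closed_topology X)"
    unfolding connected_space_clopen_in topspace_locally_closed_topology by blast
next
  assume "connected_space (locally_closed_topology X)"
  then have "U = {} \<or> U = topspace X" if "openin X U" for U
    using openin_imp_clopen_locally_closed_topology[OF that]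
    unfolding connected_space_clopen_in topspace_locally_closed_topology by blast
  then show "indiscrete_space X"
    unfolding indiscrete_space_def by (metis openin_empty openin_topspace)
qed

end
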